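(* For every unsatisfiable CNF formula $F$, $\mathrm{size}(F\vdash_{\mathrm{MaxResW}}\Box)\le 2\,\mathrm{size}(F\vdash_{\mathrm{TreeRes}}\Box)$.
   Context: $\mathrm{size}(F\vdash_P\Box)$ denotes the minimum size of a refutation of $F$ in the proof system $P$. Clauses are disjunctions of sets of literals with no complementary pair. $\Box$ is the empty clause. TreeRes (tree-like resolution): refutations using the resolution rule (from $C\vee x$ and $D\vee\overline{x}$ infer $C\vee D$), and optionally the weakening rule (from $C$ infer $C\vee x$), deriving $\Box$ from the clauses of $F$, where the underlying derivation graph is a tree (a clause used several times, including an axiom, must be rederived/relisted each time). The size is the number of clauses (nodes) in the tree. MaxSAT resolution rule: from $x\vee A$ and $\overline{x}\vee B$ with $A=a_1\vee\dots\vee a_s$, $B=b_1\vee\dots\vee b_t$, derive $A\vee B$; the clauses $x\vee A\vee b_1\vee\dots\vee b_{j-1}\vee\overline{b_j}$ for $1\le j\le t$; and the clauses $\overline{x}\vee B\vee a_1\vee\dots\vee a_{j-1}\vee\overline{a_j}$ for $1\le j\le s$. MaxSAT weakening rule: replace a clause $A$ by the two clauses $A\vee x$ and $A\vee\overline{x}$. When a rule is applied to a multi-set of clauses, (one copy of) each antecedent is removed and all non-tautologous consequents are added. A MaxResW refutation of $F$ is a sequence of multi-sets $F=F_0,F_1,\dots,F_s$, each obtained from the previous one by one application of the MaxSAT resolution rule or the MaxSAT weakening rule, with $\Box\in F_s$; its size is $s$. *)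

theory Defs
  imports Main "HOL-Library.Multiset" "HOL-Library.Extended_Nat"
begin

datatype 'v literal = Pos 'v | Neg 'v

fun negate :: "'v literal \<Rightarrow> 'v literal" where
  "negate (Pos x) = Neg x"
| "negate (Neg x) = Pos x"

type_synonym 'v clause = "'v literal set"

definition is_clause :: "'v clause \<Rightarrow> bool" where
  "is_clause C \<longleftrightarrow> finite C \<and> (\<forall>l\<in>C. negate l \<notin> C)"

definition is_cnf :: "'v clause multiset \<Rightarrow> bool" where
  "is_cnf F \<longleftrightarrow> (\<forall>C\<in>#F. is_clause C)"

fun literal_holds :: "('v \<Rightarrow> bool) \<Rightarrow> 'v literal \<Rightarrow> bool" where
  "literal_holds \<alpha> (Pos x) = \<alpha> x"
| "literal_holds \<alpha> (Neg x) = (\<not> \<alpha> x)"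

definition satisfiable :: "'v clause multiset \<Rightarrow> bool" where
  "satisfiable F \<longleftrightarrow> (\<exists>\<alpha>. \<forall>C\<in>#F. \<exists>l\<in>C. literal_holds \<alpha> l)"

(* tree_res F C n: the clause C has a tree-like derivation from F whose tree has n nodes.
   Since the premises of a rule are derived separately, a clause used several times
   (in particular an axiom) is counted once for each use. *)
inductive tree_res :: "'v clause multiset \<Rightarrow> 'v clause \<Rightarrow> nat \<Rightarrow> bool"
  for F :: "'v clause multiset" where
  axiom: "C \<in># F \<Longrightarrow> tree_res F C 1"
| resolution:
    "\<lbrakk>tree_res F (insert (Pos x) C) m; tree_res F (insert (Neg x) D) n;
      Pos x \<notin> C; Neg x \<notin> D; is_clause (C \<union> D)\<rbrakk>
     \<Longrightarrow> tree_res F (C \<union> D) (m + n + 1)"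
| weakening:
    "\<lbrakk>tree_res F C n; is_clause (insert l C)\<rbrakk> \<Longrightarrow> tree_res F (insert l C) (n + 1)"

(* For ls = [l_1, ..., l_k]: the multiset of the clauses
   C \<or> l_1 \<or> ... \<or> l_{j-1} \<or> negate l_j  with 1 \<le> j \<le> k. *)
definition chain_clauses :: "'v clause \<Rightarrow> 'v literal list \<Rightarrow> 'v clause multiset" where
  "chain_clauses C ls =
     mset (map (\<lambda>j. insert (negate (ls ! j)) (C \<union> set (take j ls))) [0..<length ls])"

(* The lists as and bs fix the order in which the literals of the two antecedents
   are enumerated; every order is allowed. *)
definition max_res_consequents ::
    "'v \<Rightarrow> 'v literal list \<Rightarrow> 'v literal list \<Rightarrow> 'v clause multiset" where
  "max_res_consequents x as bs =
     {#set as \<union> set bs#}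
     + chain_clauses (insert (Pos x) (set as)) bs
     + chain_clauses (insert (Neg x) (set bs)) as"

(* All consequents are finite sets, so filtering by is_clause discards exactly the
   tautologous ones. *)
inductive max_resW_step :: "'v clause multiset \<Rightarrow> 'v clause multiset \<Rightarrow> bool" where
  resolution:
    "\<lbrakk>distinct as; distinct bs; Pos x \<notin> set as; Neg x \<notin> set bs\<rbrakk>
     \<Longrightarrow> max_resW_step
           (M + {#insert (Pos x) (set as), insert (Neg x) (set bs)#})
           (M + filter_mset is_clause (max_res_consequents x as bs))"
| weakening:
    "max_resW_step
       (M + {#A#})
       (M + filter_mset is_clause {#insert (Pos x) A, insert (Neg x) A#})"

(* The minimum over all refutations; it is \<infinity> if there is none. *)
definition tree_res_size :: "'v clause multiset \<Rightarrow> enat" where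
  "tree_res_size F = Inf {enat n | n. tree_res F {} n}"

definition max_resW_size :: "'v clause multiset \<Rightarrow> enat" where
  "max_resW_size F = Inf {enat s | s. \<exists>G. (max_resW_step ^^ s) F G \<and> {} \<in># G}"

end

theory Submission
  imports Defs
begin

text \<open>
  View a tree-like refutation as a decision tree whose nodes carry the clause \<open>E\<close> of the
  literals falsified so far. An axiom used at several leaves has to be split by weakening, since
  MaxSAT resolution consumes its antecedents: at a query of \<open>x\<close>, each axiom used in both subtrees
  is weakened on \<open>x\<close>, and each subtree gets one of the two copies. Splitting only where both
  subtrees need the axiom costs one step less than the number of its leaves. Afterwards the tree
  is evaluated bottom-up, with at most one resolution step per query.
\<close>

section \<open>Clauses without complementary pairs\<close>

lemma is_clause_subset: "is_clause D \<Longrightarrow> C \<subseteq> D \<Longrightarrow> is_clause C"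
  by (auto simp: is_clause_def intro: finite_subset)

lemma negate_negate [simp]: "negate (negate l) = l"
  by (cases l) auto

lemma is_clause_insert:
  assumes "is_clause C" "negate l \<notin> C"
  shows "is_clause (insert l C)"
proof -
  have "negate l \<noteq> l" by (cases l) auto
  moreover have "negate k \<noteq> l" if "k \<in> C" for k
    using that assms(2) by (metis negate_negate)
  ultimately show ?thesis
    using assms by (auto simp: is_clause_def)
qed

section \<open>Composing MaxSAT steps\<close>

text \<open>A rule touches only its antecedents, so the untouched part \<open>L\<close> absorbs
  \<open>K\<close>. Two subtrees can therefore be evaluated one after the other inside a common
  multiset.\<close>

lemma max_resW_step_frame:
  assumes "max_resW_step M N"
  shows "max_resW_step (M + K) (N + K)"
  using assms
proof cases
  case (resolution as bs x L)
  with max_resW_step.resolution[of as bs x "L + K"] show ?thesis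
    by (simp add: ac_simps)
next
  case (weakening L A x)
  with max_resW_step.weakening[of "L + K" A x] show ?thesis
    by (simp add: ac_simps)
qed

lemma max_resW_steps_frame:
  "(max_resW_step ^^ s) M N \<Longrightarrow> (max_resW_step ^^ s) (M + K) (N + K)"
proof (induction s arbitrary: N)
  case (Suc s)
  then show ?case by (auto intro!: relcomppI dest: max_resW_step_frame)
qed simp

lemma max_resW_steps_trans:
  "(max_resW_step ^^ s) L M \<Longrightarrow> (max_resW_step ^^ t) M N \<Longrightarrow> (max_resW_step ^^ (s + t)) L N"
  by (auto simp: relpowp_add)

text \<open>One weakening per element of \<open>W\<close>; the hypotheses ensure that the tautology
  filter discards neither copy. Indexing by \<open>W\<close> keeps multiplicities right when
  \<open>f\<close> identifies clauses.\<close>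

lemma max_resW_weakenings:
  assumes "finite W"
    and "\<And>C. C \<in> W \<Longrightarrow> is_clause (insert (Pos x) (f C))"
    and "\<And>C. C \<in> W \<Longrightarrow> is_clause (insert (Neg x) (f C))"
  shows "(max_resW_step ^^ card W) (image_mset f (mset_set W))
    (image_mset (\<lambda>C. insert (Pos x) (f C)) (mset_set W)
      + image_mset (\<lambda>C. insert (Neg x) (f C)) (mset_set W))"
  using assms
proof (induction W rule: finite_induct)
  case (insert C W)
  have "max_resW_step {#f C#} {#insert (Pos x) (f C), insert (Neg x) (f C)#}"
    using max_resW_step.weakening[of "{#}" "f C" x] insert.prems by simp
  then have "(max_resW_step ^^ 1) {#f C#} {#insert (Pos x) (f C), insert (Neg x) (f C)#}"
    by (simp only: relpowp_1)
  note one = max_resW_steps_frame[OF this]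
  note rest = max_resW_steps_frame[OF insert.IH[OF insert.prems], of "{#f C#}"]
  have "(max_resW_step ^^ (card W + 1))
      (image_mset f (mset_set W) + {#f C#})
      ({#insert (Pos x) (f C), insert (Neg x) (f C)#}
        + (image_mset (\<lambda>C. insert (Pos x) (f C)) (mset_set W)
        + image_mset (\<lambda>C. insert (Neg x) (f C)) (mset_set W)))"
    by (rule max_resW_steps_trans[OF rest]) (use one in \<open>auto simp: ac_simps\<close>)
  then show ?case
    using insert.hyps by (simp add: ac_simps)
qed simp

text \<open>Only the resolvent matters later: being a clause, it survives the filter, and
  \<open>N\<close> absorbs the remaining consequents.\<close>

lemma max_resW_resolve:
  assumes "finite C" "finite D" "Pos x \<in> C" "Neg x \<in> D"
    and "is_clause (C - {Pos x} \<union> (D - {Neg x}))"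
  shows "\<exists>N. max_resW_step {#C, D#} (add_mset (C - {Pos x} \<union> (D - {Neg x})) N)"
proof -
  obtain as where as: "set as = C - {Pos x}" "distinct as"
    using finite_distinct_list[of "C - {Pos x}"] assms by auto
  obtain bs where bs: "set bs = D - {Neg x}" "distinct bs"
    using finite_distinct_list[of "D - {Neg x}"] assms by auto
  have "insert (Pos x) (set as) = C" "insert (Neg x) (set bs) = D"
    using as bs assms by auto
  with max_resW_step.resolution[of as bs x "{#}"] as bs assms(5) show ?thesis
    by (auto simp: max_res_consequents_def)
qed

text \<open>
  The set \<open>U\<close> holds the axioms used below a node with falsified clause \<open>E\<close>, and \<open>f C\<close> is the copy
  of \<open>C\<close> that arrives at the node. The slack \<open>card U\<close> in the bound on the number of steps pays for
  the weakenings of the axioms shared between two subtrees.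
\<close>

definition max_resW_simulates :: "'v clause set \<Rightarrow> 'v clause \<Rightarrow> nat \<Rightarrow> bool" where
  "max_resW_simulates U E n \<longleftrightarrow>
     finite U \<and> (\<forall>C\<in>U. is_clause (C \<union> E)) \<and>
     (\<forall>f. (\<forall>C\<in>U. f C \<subseteq> C \<union> E) \<longrightarrow>
        (\<exists>s D N. s + card U \<le> n \<and> D \<subseteq> E \<and>
           (max_resW_step ^^ s) (image_mset f (mset_set U)) (add_mset D N)))"

lemma max_resW_simulates_mono:
  "max_resW_simulates U E m \<Longrightarrow> m \<le> n \<Longrightarrow> max_resW_simulates U E n"
  unfolding max_resW_simulates_def by (meson order_trans)

text \<open>A leaf takes no step: \<open>C \<subseteq> E\<close> puts the arriving copy inside
  \<open>E\<close>, and the size 1 pays for \<open>card {C}\<close>.\<close>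

lemma max_resW_simulates_axiom:
  assumes "is_clause E" "C \<subseteq> E"
  shows "max_resW_simulates {C} E 1"
proof -
  have "\<exists>s D N. s + card {C} \<le> 1 \<and> D \<subseteq> E \<and>
      (max_resW_step ^^ s) (image_mset f (mset_set {C})) (add_mset D N)"
    if "f C \<subseteq> C \<union> E" for f
    using that assms by (intro exI[of _ 0] exI[of _ "f C"] exI[of _ "{#}"]) auto
  then show ?thesis
    using assms by (auto simp: max_resW_simulates_def Un_absorb1)
qed

lemma image_mset_split:
  assumes "finite U" "W \<subseteq> U"
  shows "image_mset (\<lambda>C. if C \<in> W then g C else f C) (mset_set U) =
    image_mset g (mset_set W) + image_mset f (mset_set (U - W))"
proof -
  have fin: "finite W" using assms finite_subset by blast
  have "mset_set U = mset_set W + mset_set (U - W)"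
    using mset_set_Union[of W "U - W"] assms fin by (simp add: Un_absorb1)
  moreover have "image_mset (\<lambda>C. if C \<in> W then g C else f C) (mset_set W) = image_mset g (mset_set W)"
    using fin by (intro image_mset_cong) simp
  moreover have "image_mset (\<lambda>C. if C \<in> W then g C else f C) (mset_set (U - W)) = image_mset f (mset_set (U - W))"
    using assms by (intro image_mset_cong) simp
  ultimately show ?thesis by simp
qed

text \<open>The budget balances by inclusion-exclusion: \<open>card U1 + card U2\<close> exceeds
  \<open>card (U1 \<union> U2)\<close> by exactly the number of shared axioms, each of which costs
  one weakening. The extra 1 pays for resolving on \<open>x\<close>.\<close>

lemma max_resW_simulates_query:
  assumes sim1: "max_resW_simulates U1 (insert (Pos x) E) m"
    and sim2: "max_resW_simulates U2 (insert (Neg x) E) n"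
    and E: "is_clause E"
  shows "max_resW_simulates (U1 \<union> U2) E (m + n + 1)"
proof -
  have fin: "finite U1" "finite U2"
    using assms by (auto simp: max_resW_simulates_def)
  have cl1: "is_clause (C \<union> insert (Pos x) E)" if "C \<in> U1" for C
    using sim1 that by (auto simp: max_resW_simulates_def)
  have cl2: "is_clause (C \<union> insert (Neg x) E)" if "C \<in> U2" for C
    using sim2 that by (auto simp: max_resW_simulates_def)
  have cl: "is_clause (C \<union> E)" if "C \<in> U1 \<union> U2" for C
    using that is_clause_subset[OF cl1[of C]] is_clause_subset[OF cl2[of C]] by blast
  have "\<exists>s D N. s + card (U1 \<union> U2) \<le> m + n + 1 \<and> D \<subseteq> E \<and>
      (max_resW_step ^^ s) (image_mset f (mset_set (U1 \<union> U2))) (add_mset D N)"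
    if f: "\<forall>C\<in>U1 \<union> U2. f C \<subseteq> C \<union> E" for f
  proof -
    define W where "W = U1 \<inter> U2"
    \<comment> \<open>Shared axioms enter each subtree as the copy weakened by the literal that this
      branch adds to \<open>E\<close>; all others are passed on unchanged.\<close>
    define f1 where "f1 = (\<lambda>C. if C \<in> W then insert (Pos x) (f C) else f C)"
    define f2 where "f2 = (\<lambda>C. if C \<in> W then insert (Neg x) (f C) else f C)"
    let ?M1 = "image_mset f1 (mset_set U1)"
    let ?M2 = "image_mset f2 (mset_set U2)"
    have W: "finite W" "W \<subseteq> U1" "W \<subseteq> U2" using fin by (auto simp: W_def)
    have card: "card U1 + card U2 = card (U1 \<union> U2) + card W"
      unfolding W_def by (rule card_Un_Int[OF fin])
    have "U1 \<union> U2 = W \<union> ((U1 - W) \<union> (U2 - W))" using W by auto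
    moreover have "mset_set (W \<union> ((U1 - W) \<union> (U2 - W)))
        = mset_set W + (mset_set (U1 - W) + mset_set (U2 - W))"
      using fin W by (subst mset_set_Union; (subst mset_set_Union)?) (auto simp: W_def)
    ultimately have split: "image_mset f (mset_set (U1 \<union> U2)) = image_mset f (mset_set W)
        + (image_mset f (mset_set (U1 - W)) + image_mset f (mset_set (U2 - W)))"
      by simp
    have M1: "?M1 = image_mset (\<lambda>C. insert (Pos x) (f C)) (mset_set W) + image_mset f (mset_set (U1 - W))"
      unfolding f1_def using fin W by (intro image_mset_split)
    have M2: "?M2 = image_mset (\<lambda>C. insert (Neg x) (f C)) (mset_set W) + image_mset f (mset_set (U2 - W))"
      unfolding f2_def using fin W by (intro image_mset_split)
    have "(max_resW_step ^^ card W) (image_mset f (mset_set W))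
      (image_mset (\<lambda>C. insert (Pos x) (f C)) (mset_set W)
        + image_mset (\<lambda>C. insert (Neg x) (f C)) (mset_set W))"
    proof (rule max_resW_weakenings[OF W(1)])
      fix C assume C: "C \<in> W"
      then have "f C \<subseteq> C \<union> E" using f W by blast
      \<comment> \<open>A shared \<open>C\<close> satisfies both \<open>cl1\<close> and
        \<open>cl2\<close>, so \<open>C \<union> E\<close> is compatible with either literal of
        \<open>x\<close>.\<close>
      then show "is_clause (insert (Pos x) (f C))" "is_clause (insert (Neg x) (f C))"
        using is_clause_subset[OF cl1[of C], of "insert (Pos x) (f C)"]
          is_clause_subset[OF cl2[of C], of "insert (Neg x) (f C)"] C W by auto
    qed
    from max_resW_steps_frame[OF this, of "image_mset f (mset_set (U1 - W)) + image_mset f (mset_set (U2 - W))"]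
    have weaken: "(max_resW_step ^^ card W) (image_mset f (mset_set (U1 \<union> U2))) (?M1 + ?M2)"
      by (simp only: split M1 M2 ac_simps)
    have "\<forall>C\<in>U1. f1 C \<subseteq> C \<union> insert (Pos x) E"
      using f by (auto simp: f1_def)
    then obtain s D1 N1 where s: "s + card U1 \<le> m" "D1 \<subseteq> insert (Pos x) E"
      "(max_resW_step ^^ s) ?M1 (add_mset D1 N1)"
      using sim1 unfolding max_resW_simulates_def by blast
    have "\<forall>C\<in>U2. f2 C \<subseteq> C \<union> insert (Neg x) E"
      using f by (auto simp: f2_def)
    then obtain t D2 N2 where t: "t + card U2 \<le> n" "D2 \<subseteq> insert (Neg x) E"
      "(max_resW_step ^^ t) ?M2 (add_mset D2 N2)"
      using sim2 unfolding max_resW_simulates_def by blast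
    have "(max_resW_step ^^ (card W + s)) (image_mset f (mset_set (U1 \<union> U2))) (add_mset D1 N1 + ?M2)"
      using weaken max_resW_steps_frame[OF s(3)] by (rule max_resW_steps_trans)
    moreover have "(max_resW_step ^^ t) (add_mset D1 N1 + ?M2) (add_mset D1 N1 + add_mset D2 N2)"
      using max_resW_steps_frame[OF t(3), of "add_mset D1 N1"] by (simp only: add.commute)
    ultimately have both: "(max_resW_step ^^ (card W + s + t))
        (image_mset f (mset_set (U1 \<union> U2))) (add_mset D1 N1 + add_mset D2 N2)"
      by (rule max_resW_steps_trans)
    \<comment> \<open>A result that avoids the queried literal already lies in \<open>E\<close>, and
      the other result joins the leftover clauses; otherwise both literals of \<open>x\<close> occur
      and can be resolved away.\<close>
    consider "D1 \<subseteq> E" | "D2 \<subseteq> E" | "Pos x \<in> D1" "Neg x \<in> D2"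
      using s(2) t(2) by blast
    then show ?thesis
    proof cases
      case 1
      then show ?thesis
        using both s(1) t(1) card
        by (intro exI[of _ "card W + s + t"] exI[of _ D1] exI[of _ "N1 + add_mset D2 N2"]) (auto simp: add_mset_commute)
    next
      case 2
      then show ?thesis
        using both s(1) t(1) card
        by (intro exI[of _ "card W + s + t"] exI[of _ D2] exI[of _ "add_mset D1 N1 + N2"]) (auto simp: add_mset_commute)
    next
      case 3
      let ?D = "D1 - {Pos x} \<union> (D2 - {Neg x})"
      have D: "?D \<subseteq> E" using s(2) t(2) by blast
      have "finite E" using E by (simp add: is_clause_def)
      then have "finite D1" "finite D2"
        using s(2) t(2) by (meson finite_insert finite_subset)+
      then obtain N where "max_resW_step {#D1, D2#} (add_mset ?D N)"
        using max_resW_resolve[of D1 D2 x] 3 is_clause_subset[OF E D] by blast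
      from max_resW_step_frame[OF this, of "N1 + N2"]
      have "max_resW_step (add_mset D1 N1 + add_mset D2 N2) (add_mset ?D (N + N1 + N2))"
        by (simp add: ac_simps add_mset_commute)
      then have "(max_resW_step ^^ 1) (add_mset D1 N1 + add_mset D2 N2) (add_mset ?D (N + N1 + N2))"
        by (simp only: relpowp_1)
      with both have "(max_resW_step ^^ (card W + s + t + 1))
          (image_mset f (mset_set (U1 \<union> U2))) (add_mset ?D (N + N1 + N2))"
        by (rule max_resW_steps_trans)
      moreover have "card W + s + t + 1 + card (U1 \<union> U2) \<le> m + n + 1"
        using s(1) t(1) card by simp
      ultimately show ?thesis using D by blast
    qed
  qed
  then show ?thesis
    unfolding max_resW_simulates_def using fin cl by auto
qed

text \<open>Generalizing from \<open>C\<close> to any clause \<open>E\<close> above it lets the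
  induction follow branches down from the root. A weakening needs no step, since its premise is also
  contained in \<open>E\<close>.\<close>

lemma tree_res_imp_max_resW_simulates:
  assumes "tree_res F C n" "is_clause E" "C \<subseteq> E"
  shows "\<exists>U\<subseteq>set_mset F. max_resW_simulates U E n"
  using assms
proof (induction arbitrary: E)
  case (axiom C)
  then show ?case
    by (intro exI[of _ "{C}"]) (use max_resW_simulates_axiom in auto)
next
  case (resolution x C m D n)
  \<comment> \<open>If \<open>E\<close> already decides \<open>x\<close>, the premise with that
    literal lies in \<open>E\<close>; its subtree alone suffices and the other is pruned.\<close>
  consider "Pos x \<in> E" | "Neg x \<in> E" | "Pos x \<notin> E" "Neg x \<notin> E" by blast
  then show ?case
  proof cases
    case 1
    then obtain U where "U \<subseteq> set_mset F" "max_resW_simulates U E m"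
      using resolution.IH(1)[of E] resolution.prems by auto
    then show ?thesis
      using max_resW_simulates_mono[of U E m "m + n + 1"] by auto
  next
    case 2
    then obtain U where "U \<subseteq> set_mset F" "max_resW_simulates U E n"
      using resolution.IH(2)[of E] resolution.prems by auto
    then show ?thesis
      using max_resW_simulates_mono[of U E n "m + n + 1"] by auto
  next
    case 3
    then have "is_clause (insert (Pos x) E)" "is_clause (insert (Neg x) E)"
      using resolution.prems(1) by (simp_all add: is_clause_insert)
    then obtain U1 U2 where U: "U1 \<subseteq> set_mset F" "U2 \<subseteq> set_mset F"
      and sim: "max_resW_simulates U1 (insert (Pos x) E) m" "max_resW_simulates U2 (insert (Neg x) E) n"
      using resolution.IH(1)[of "insert (Pos x) E"] resolution.IH(2)[of "insert (Neg x) E"]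
        resolution.prems(2) by (auto simp: subset_insertI2)
    from max_resW_simulates_query[OF sim resolution.prems(1)] U show ?thesis
      by (intro exI[of _ "U1 \<union> U2"]) simp
  qed
next
  case (weakening C n l)
  then show ?case
    by (metis insert_subset le_add1 max_resW_simulates_mono)
qed

section \<open>Refutations and their minimum sizes\<close>

lemma tree_res_imp_max_resW:
  assumes "tree_res F {} n"
  shows "\<exists>s\<le>n. \<exists>G. (max_resW_step ^^ s) F G \<and> {} \<in># G"
proof -
  have "is_clause {}" by (simp add: is_clause_def)
  then obtain U where U: "U \<subseteq> set_mset F" and sim: "max_resW_simulates U {} n"
    using tree_res_imp_max_resW_simulates[OF assms] by blast
  \<comment> \<open>At the root every axiom is its own copy, hence \<open>id\<close>, and the empty
    \<open>E\<close> forces \<open>D\<close> to be the empty clause.\<close>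
  from sim have "\<exists>s D N. s + card U \<le> n \<and> D \<subseteq> {} \<and>
      (max_resW_step ^^ s) (image_mset id (mset_set U)) (add_mset D N)"
    unfolding max_resW_simulates_def by (metis Un_upper1 id_apply)
  then obtain s N where s: "s + card U \<le> n" "(max_resW_step ^^ s) (mset_set U) (add_mset {} N)"
    by auto
  \<comment> \<open>One occurrence of each used axiom suffices; the rest of \<open>F\<close> is
    framed.\<close>
  have "mset_set U \<subseteq># F"
    using U by (meson finite_set_mset mset_set_set_mset_msubset msubset_mset_set_iff
        rev_finite_subset subset_mset.order_trans)
  then have "mset_set U + (F - mset_set U) = F" by simp
  then have "(max_resW_step ^^ s) F (add_mset {} N + (F - mset_set U))"
    using max_resW_steps_frame[OF s(2), of "F - mset_set U"] by simp
  then show ?thesis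
    using s(1) by (intro exI[of _ s]) auto
qed

theorem lemma3p1:
  fixes F :: "'v clause multiset"
  assumes "is_cnf F"
    and "\<not> satisfiable F"
  shows "max_resW_size F \<le> 2 * tree_res_size F"
proof -
  \<comment> \<open>The simulation takes at most as many steps as the tree has nodes, which gives
    the sharper factor 1.\<close>
  have "max_resW_size F \<le> tree_res_size F"
    unfolding tree_res_size_def
  proof (rule Inf_greatest)
    fix e assume "e \<in> {enat n |n. tree_res F {} n}"
    then obtain n where n: "e = enat n" "tree_res F {} n" by blast
    then obtain s G where "s \<le> n" "(max_resW_step ^^ s) F G \<and> {} \<in># G"
      using tree_res_imp_max_resW by blast
    then have "max_resW_size F \<le> enat s"
      unfolding max_resW_size_def by (intro Inf_lower) blast
    also have "\<dots> \<le> e" using n \<open>s \<le> n\<close> by simp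
    finally show "max_resW_size F \<le> e" .
  qed
  also have "\<dots> \<le> 2 * tree_res_size F"
    by (cases "tree_res_size F") (auto simp: numeral_eq_enat)
  finally show ?thesis .
qed

end
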